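(* If $(R,\mathfrak{m})$ is a commutative local P.Z. ring with Krull dimension $\dim(R)=1$, then every infinite subset of $\operatorname{Spec}(R)$ is dense in $\operatorname{Spec}(R)$ with respect to the flat topology.
   Context: All rings are commutative. A local ring $(R,\mathfrak{m})$ is a ring with a unique maximal ideal $\mathfrak{m}$ (not assumed Noetherian). A P.Z. (properly zipped) ring is a ring $R$ satisfying infinite prime absorbance: if a prime ideal $\mathfrak{p}$ of $R$ contains the intersection of a family $(\mathfrak{p}_i)$ of prime ideals of $R$, then $\mathfrak{p}_k\subseteq\mathfrak{p}$ for some $k$. The flat topology on $\operatorname{Spec}(R)$ is the topology for which the sets $V(a)=\{\mathfrak{p}\in\operatorname{Spec}(R): a\in\mathfrak{p}\}$, $a\in R$, form a sub-basis of open sets; equivalently, the sets $V(I)$ with $I$ a finitely generated ideal form a basis of open sets. *)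

theory Defs
  imports "HOL-Algebra.Ideal" "HOL-Analysis.Function_Topology" "HOL-Library.Extended_Real"
begin

definition Spec :: "('a, 'b) ring_scheme \<Rightarrow> 'a set set" where
  "Spec R = {P. primeideal P R}"

definition local_cring :: "('a, 'b) ring_scheme \<Rightarrow> 'a set \<Rightarrow> bool" where
  "local_cring R m \<longleftrightarrow> cring R \<and> maximalideal m R \<and> (\<forall>J. maximalideal J R \<longrightarrow> J = m)"

text \<open>Intersecting with the carrier makes the intersection of the empty family equal to the
  whole ring (and changes nothing for nonempty families).\<close>

definition pz_ring :: "('a, 'b) ring_scheme \<Rightarrow> bool" where
  "pz_ring R \<longleftrightarrow> cring R \<and>
     (\<forall>P\<in>Spec R. \<forall>F. F \<subseteq> Spec R \<longrightarrow> carrier R \<inter> \<Inter>F \<subseteq> P \<longrightarrow> (\<exists>Q\<in>F. Q \<subseteq> P))"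

text \<open>The supremum is taken in the extended reals, so a ring without prime ideals has
  dimension \<open>-\<infinity>\<close> and a ring with arbitrarily long chains has dimension \<open>\<infinity>\<close>.\<close>

definition krull_dim :: "('a, 'b) ring_scheme \<Rightarrow> ereal" where
  "krull_dim R = Sup {ereal (real n) | n. \<exists>P :: nat \<Rightarrow> 'a set.
     (\<forall>i\<le>n. P i \<in> Spec R) \<and> (\<forall>i<n. P i \<subset> P (Suc i))}"

definition flat_topology :: "('a, 'b) ring_scheme \<Rightarrow> 'a set topology" where
  "flat_topology R = topology_generated_by ((\<lambda>a. {P \<in> Spec R. a \<in> P}) ` carrier R)"

lemma topspace_flat_topology: "topspace (flat_topology R) = Spec R"
proof -
  have "P \<in> (\<Union>a\<in>carrier R. {P \<in> Spec R. a \<in> P})" if "P \<in> Spec R" for P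
  proof -
    have "ideal P R"
      using that by (simp add: Spec_def primeideal_def)
    then have "\<zero>\<^bsub>R\<^esub> \<in> P" "\<zero>\<^bsub>R\<^esub> \<in> carrier R"
      by (simp_all add: additive_subgroup.zero_closed ideal.axioms(1) ideal.axioms(2) ring.ring_simprules(2))
    with that show ?thesis by (intro UN_I[of "\<zero>\<^bsub>R\<^esub>"]) simp_all
  qed
  moreover have "(\<Union>a\<in>carrier R. {P \<in> Spec R. a \<in> P}) \<subseteq> Spec R"
    by (rule UN_least) (rule Collect_restrict)
  ultimately have "(\<Union>a\<in>carrier R. {P \<in> Spec R. a \<in> P}) = Spec R"
    by (intro subset_antisym subsetI)  (rule subsetD)
  then show ?thesis
    unfolding flat_topology_def topology_generated_by_topspace .
qed

end

theory Submission
  imports Defs "HOL-Algebra.Ring_Divisibility"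
begin

text \<open>Every non-maximal prime \<open>P\<close> is minimal, so applying infinite prime absorbance to all
  the other primes yields an element avoiding \<open>P\<close> and nothing else: \<open>{P}\<close> is Zariski open.
  For \<open>a\<close> in the maximal ideal, the Zariski open set of primes avoiding \<open>a\<close> consists of
  non-maximal primes, hence is discrete; being quasi-compact it is finite. So the nonempty
  subbasic open sets of the flat topology are cofinite, and then so are all its nonempty open
  sets, each of which therefore meets every infinite set.\<close>

text \<open>Zorn's lemma on the ideals over \<open>I\<close> that miss \<open>S\<close>: unions of
  nonempty chains keep both conditions. Taking \<open>S\<close> as {\<one>} yields maximal ideals,
  taking the powers of an element yields primes.\<close>

lemma (in ring) exists_ideal_maximal_disjoint:
  assumes "ideal I R" "I \<inter> S = {}"
  shows "\<exists>M. ideal M R \<and> I \<subseteq> M \<and> M \<inter> S = {} \<and>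
           (\<forall>J. ideal J R \<and> M \<subseteq> J \<and> J \<inter> S = {} \<longrightarrow> J = M)"
proof -
  let ?F = "{J. ideal J R \<and> I \<subseteq> J \<and> J \<inter> S = {}}"
  have "\<exists>M\<in>?F. \<forall>X\<in>?F. M \<subseteq> X \<longrightarrow> X = M"
  proof (rule subset_Zorn_nonempty)
    show "?F \<noteq> {}" using assms by blast
  next
    fix C assume C: "C \<noteq> {}" "subset.chain ?F C"
    then have sub: "C \<subseteq> ?F" and "subset.chain {J. ideal J R} C"
      unfolding pred_on.chain_def by blast+
    then have "ideal (\<Union>C) R"
      using chain_Union_is_ideal[of C] C(1) by simp
    then show "\<Union>C \<in> ?F" using sub C(1) by blast
  qed
  then obtain M where M: "M \<in> ?F" "\<forall>X\<in>?F. M \<subseteq> X \<longrightarrow> X = M" ..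
  have "J = M" if "ideal J R" "M \<subseteq> J" "J \<inter> S = {}" for J
    using M(1) that by (intro M(2)[rule_format]) auto
  with M(1) show ?thesis by auto
qed

text \<open>An ideal is proper exactly when it misses \<one>, so maximality among ideals disjoint
  from {\<one>} is ordinary maximality.\<close>

lemma (in cring) exists_maximalideal_containing:
  assumes "ideal I R" "I \<noteq> carrier R"
  shows "\<exists>M. maximalideal M R \<and> I \<subseteq> M"
proof -
  have proper: "J \<inter> {\<one>} = {} \<longleftrightarrow> J \<noteq> carrier R" if "ideal J R" for J
    using ideal.one_imp_carrier[OF that] one_closed by blast
  obtain M where M: "ideal M R" "I \<subseteq> M" "M \<inter> {\<one>} = {}"
      "\<And>J. ideal J R \<Longrightarrow> M \<subseteq> J \<Longrightarrow> J \<inter> {\<one>} = {} \<Longrightarrow> J = M"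
    using exists_ideal_maximal_disjoint[of I "{\<one>}"] assms proper by metis
  have "maximalideal M R"
    using M proper by (intro maximalidealI) blast+
  with M(2) show ?thesis by blast
qed

text \<open>An ideal that is maximal among those missing all powers of \<open>a\<close> is
  prime.\<close>

lemma (in cring) exists_primeideal_avoiding:
  assumes "ideal I R" "a \<in> carrier R" "\<And>n::nat. a [^] n \<notin> I"
  shows "\<exists>P. primeideal P R \<and> I \<subseteq> P \<and> a \<notin> P"
proof -
  let ?S = "range (\<lambda>n::nat. a [^] n)"
  have "I \<inter> ?S = {}" using assms(3) by blast
  then obtain M where M: "ideal M R" "I \<subseteq> M" "M \<inter> ?S = {}"
      and max: "\<And>J. ideal J R \<Longrightarrow> M \<subseteq> J \<Longrightarrow> J \<inter> ?S = {} \<Longrightarrow> J = M"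
    using exists_ideal_maximal_disjoint[OF assms(1), of ?S] by metis
  interpret M: ideal M R by (rule M(1))
  have pow: "a [^] n \<notin> M" for n :: nat using M(3) by blast
  \<comment> \<open>The colon ideal of \<open>M\<close> by \<open>x\<close> contains
    \<open>M\<close> and also \<open>y\<close>, which lies outside \<open>M\<close>; by maximality
    it must contain a power of \<open>a\<close>.\<close>
  have colon: "\<exists>n::nat. x \<otimes> a [^] n \<in> M"
    if x: "x \<in> carrier R" and y: "y \<in> carrier R" "y \<notin> M" "x \<otimes> y \<in> M" for x y
  proof -
    let ?K = "{z \<in> carrier R. x \<otimes> z \<in> M}"
    have "ideal ?K R" by (rule M.helper_max_prime[OF is_cring x])
    moreover have "M \<subseteq> ?K" using M.I_l_closed x M.Icarr by blast
    moreover have "?K \<noteq> M" using y by blast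
    ultimately have "?K \<inter> ?S \<noteq> {}" using max by blast
    then show ?thesis by blast
  qed
  have "primeideal M R"
  proof (rule primeidealI[OF M(1) is_cring])
    show "carrier R \<noteq> M" using pow[of 0] one_closed by auto
  next
    fix x y assume x: "x \<in> carrier R" and y: "y \<in> carrier R" and xy: "x \<otimes> y \<in> M"
    show "x \<in> M \<or> y \<in> M"
    proof (rule ccontr)
      assume no: "\<not> (x \<in> M \<or> y \<in> M)"
      obtain n :: nat where "x \<otimes> a [^] n \<in> M" using colon x y xy no by blast
      \<comment> \<open>Swapping the factors lets \<open>colon\<close> apply again, with
        \<open>a [^] n\<close> in the role of \<open>x\<close> and \<open>x\<close> in the role of
        \<open>y\<close>. This puts a product of two powers of \<open>a\<close> into
        \<open>M\<close>.\<close>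
      then have "a [^] n \<otimes> x \<in> M" using x assms(2) by (simp add: m_comm)
      then obtain k :: nat where "a [^] n \<otimes> a [^] k \<in> M"
        using colon[of "a [^] n" x] x no assms(2) by blast
      then show False using pow[of "n + k"] assms(2) by (simp add: nat_pow_mult)
    qed
  qed
  moreover have "a \<notin> M" using pow[of 1] assms(2) by simp
  ultimately show ?thesis using M(2) by blast
qed

lemma local_cring_prime_subset:
  assumes "local_cring R m" "P \<in> Spec R"
  shows "P \<subseteq> m"
proof -
  interpret cring R using assms(1) by (simp add: local_cring_def)
  interpret P: primeideal P R using assms(2) by (simp add: Spec_def)
  show ?thesis
    using exists_maximalideal_containing[OF P.is_ideal] P.I_notcarr assms(1)
    unfolding local_cring_def by metis
qed

lemma krull_dim_le_1_no_chain:
  assumes "krull_dim R \<le> 1" "P \<in> Spec R" "Q \<in> Spec R" "M \<in> Spec R"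
  shows "\<not> (P \<subset> Q \<and> Q \<subset> M)"
proof
  assume "P \<subset> Q \<and> Q \<subset> M"
  then have "\<exists>c :: nat \<Rightarrow> 'a set. (\<forall>i\<le>2. c i \<in> Spec R) \<and> (\<forall>i<2. c i \<subset> c (Suc i))"
    using assms(2-4)
    by (intro exI[of _ "\<lambda>i. if i = 0 then P else if i = 1 then Q else M"])
       (auto simp: less_2_cases_iff)
  then have "ereal (real 2) \<le> krull_dim R"
    unfolding krull_dim_def by (intro Sup_upper) blast
  with assms(1) have "ereal (real 2) \<le> 1" by (rule order_trans[rotated])
  then show False by (simp add: one_ereal_def)
qed

text \<open>Minimality keeps every other prime from lying in \<open>P\<close>, so the contrapositive
  of absorbance gives an \<open>f\<close> outside \<open>P\<close> that lies in all of them. If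
  \<open>P\<close> is the only prime, the family is empty and its intersection is the whole
  ring.\<close>

lemma pz_ring_minimal_isolated:
  assumes "pz_ring R" "P \<in> Spec R" "\<And>Q. Q \<in> Spec R \<Longrightarrow> \<not> Q \<subset> P"
  shows "\<exists>f\<in>carrier R. {Q \<in> Spec R. f \<notin> Q} = {P}"
proof -
  have "\<not> carrier R \<inter> \<Inter>(Spec R - {P}) \<subseteq> P"
  proof
    assume "carrier R \<inter> \<Inter>(Spec R - {P}) \<subseteq> P"
    then have "\<exists>Q\<in>Spec R - {P}. Q \<subseteq> P"
      using assms(1,2) unfolding pz_ring_def by (meson Diff_subset)
    then show False using assms(3) by blast
  qed
  then show ?thesis using assms(2) by blast
qed

text \<open>Quasi-compactness of the set of primes avoiding \<open>a\<close>, for the discrete case. The elements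
  \<open>x\<close> that are avoided together with \<open>a\<close> by only finitely many primes form an ideal. If it
  contained no power of \<open>a\<close>, some prime above it would avoid \<open>a\<close>, and hence be isolated by
  an element of that ideal.\<close>

lemma (in cring) finite_isolated_primes_avoiding:
  assumes a: "a \<in> carrier R"
    and isolated: "\<And>P. P \<in> Spec R \<Longrightarrow> a \<notin> P \<Longrightarrow> \<exists>f\<in>carrier R. {Q \<in> Spec R. f \<notin> Q} = {P}"
  shows "finite {P \<in> Spec R. a \<notin> P}"
proof (rule ccontr)
  assume inf: "infinite {P \<in> Spec R. a \<notin> P}"
  define D where "D x = {P \<in> Spec R. a \<notin> P \<and> x \<notin> P}" for x
  define J where "J = {x \<in> carrier R. finite (D x)}"
  have ideal_P: "ideal P R" if "P \<in> Spec R" for P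
    using that by (simp add: Spec_def primeideal.axioms(1))
  note subgroup_P = additive_subgroup.a_closed[OF ideal.axioms(1)[OF ideal_P]]
    additive_subgroup.zero_closed[OF ideal.axioms(1)[OF ideal_P]]
    additive_subgroup.a_inv_closed[OF ideal.axioms(1)[OF ideal_P]]
  have D_add: "D (x \<oplus> y) \<subseteq> D x \<union> D y" for x y
    unfolding D_def using subgroup_P(1) by blast
  have D_mult: "D (x \<otimes> y) \<subseteq> D y" "D (y \<otimes> x) \<subseteq> D y" if "x \<in> carrier R" for x y
    using that ideal.I_l_closed[OF ideal_P] ideal.I_r_closed[OF ideal_P] by (auto simp: D_def)
  have "ideal J R"
  proof (rule idealI[OF ring_axioms])
    show "subgroup J (add_monoid R)"
    proof (rule add.subgroupI)
      show "J \<subseteq> carrier R" by (auto simp: J_def)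
      have "D \<zero> = {}" using subgroup_P(2) by (auto simp: D_def)
      then have "\<zero> \<in> J" by (simp add: J_def)
      then show "J \<noteq> {}" by blast
    next
      fix x assume "x \<in> J"
      moreover have "D (\<ominus> x) \<subseteq> D x" if "x \<in> carrier R"
        unfolding D_def using subgroup_P(3) by blast
      ultimately show "\<ominus> x \<in> J" by (auto simp: J_def intro: finite_subset)
    next
      fix x y assume "x \<in> J" "y \<in> J"
      then show "x \<oplus> y \<in> J"
        using finite_subset[OF D_add] by (simp add: J_def)
    qed
  next
    fix x y assume "x \<in> J" "y \<in> carrier R"
    then show "y \<otimes> x \<in> J" "x \<otimes> y \<in> J"
      using finite_subset[OF D_mult(1)] finite_subset[OF D_mult(2)] by (simp_all add: J_def)
  qed
  moreover have "a [^] n \<notin> J" for n :: nat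
  proof -
    \<comment> \<open>Primes avoiding \<open>a\<close> also avoid each of its powers, so
      \<open>D (a [^] n)\<close> is the whole infinite set. The case of exponent 0 is vacuous, since
      \<one> lies in no prime.\<close>
    have pow_P: "a \<in> P" if "primeideal P R" "a [^] n \<in> P" for P
      using that(2)
    proof (induction n)
      case 0
      then show ?case
        using ideal.one_imp_carrier primeideal.axioms(1) primeideal.I_notcarr that(1) by fastforce
    next
      case (Suc n)
      then show ?case using primeideal.I_prime[OF that(1), of "a [^] n" a] a by auto
    qed
    then have "D (a [^] n) = {P \<in> Spec R. a \<notin> P}"
      unfolding D_def Spec_def by blast
    with inf show ?thesis by (simp add: J_def)
  qed
  ultimately obtain P where P: "primeideal P R" "J \<subseteq> P" "a \<notin> P"
    using exists_primeideal_avoiding a by blast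
  then obtain f where f: "f \<in> carrier R" "{Q \<in> Spec R. f \<notin> Q} = {P}"
    using isolated[of P] by (auto simp: Spec_def)
  \<comment> \<open>The isolating element \<open>f\<close> is thus forced into \<open>J\<close> and
    so into \<open>P\<close>, although \<open>P\<close> avoids it.\<close>
  then have "D f \<subseteq> {P}" by (auto simp: D_def)
  then have "f \<in> J" using f(1) by (auto simp: J_def intro: finite_subset)
  with P(2) f(2) show False by blast
qed

text \<open>Being empty or cofinite in \<open>Spec R\<close> survives finite intersections and
  arbitrary unions, so it spreads from the subbasis to all open sets.\<close>

lemma openin_flat_topology_cofinite:
  assumes basic: "\<And>a. a \<in> carrier R \<Longrightarrow> \<exists>P\<in>Spec R. a \<in> P \<Longrightarrow> finite {P \<in> Spec R. a \<notin> P}"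
    and "openin (flat_topology R) U" "U \<noteq> {}"
  shows "finite (Spec R - U)"
proof -
  have "generate_topology_on ((\<lambda>a. {P \<in> Spec R. a \<in> P}) ` carrier R) U"
    using assms(2) unfolding flat_topology_def by (rule openin_topology_generated_by)
  then have "U = {} \<or> finite (Spec R - U)"
  proof induction
    case Empty
    show ?case by simp
  next
    case (Int U V)
    then show ?case by (auto simp: Diff_Int)
  next
    case (UN K)
    show ?case
    proof (cases "\<Union>K = {}")
      case False
      \<comment> \<open>A single nonempty member is already cofinite, and the union is only
        larger.\<close>
      then obtain V where "V \<in> K" "V \<noteq> {}" by blast
      then have "finite (Spec R - V)" "Spec R - \<Union>K \<subseteq> Spec R - V" using UN.IH by blast+
      then show ?thesis using finite_subset by blast
    qed simp
  next
    case (Basis U)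
    then obtain a where a: "a \<in> carrier R" "U = {P \<in> Spec R. a \<in> P}" by blast
    then have "Spec R - U = {P \<in> Spec R. a \<notin> P}" by blast
    then show ?case using basic a by auto
  qed
  with assms(3) show ?thesis by blast
qed

theorem corollary3p12:
  fixes R :: "('a, 'b) ring_scheme" and m :: "'a set"
  assumes "local_cring R m"
    and "pz_ring R"
    and "krull_dim R = 1"
    and "A \<subseteq> Spec R"
    and "infinite A"
  shows "flat_topology R closure_of A = Spec R"
proof -
  interpret cring R using assms(1) by (simp add: local_cring_def)
  have m: "m \<in> Spec R"
    using assms(1) maximalideal_prime by (simp add: local_cring_def Spec_def)
  have isolated: "\<exists>f\<in>carrier R. {Q \<in> Spec R. f \<notin> Q} = {P}" if P: "P \<in> Spec R" "P \<noteq> m" for P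
  proof (rule pz_ring_minimal_isolated[OF assms(2) P(1)])
    fix Q assume Q: "Q \<in> Spec R"
    \<comment> \<open>A prime strictly below \<open>P\<close> would extend this inclusion to a chain
      of length 2, exceeding the dimension.\<close>
    have "P \<subset> m" using local_cring_prime_subset[OF assms(1) P(1)] P(2) by blast
    then show "\<not> Q \<subset> P"
      using krull_dim_le_1_no_chain[OF _ Q P(1) m] assms(3) by simp
  qed
  have "finite {P \<in> Spec R. a \<notin> P}" if a: "a \<in> carrier R" "\<exists>P\<in>Spec R. a \<in> P" for a
  proof (rule finite_isolated_primes_avoiding[OF a(1)])
    fix P assume P: "P \<in> Spec R" "a \<notin> P"
    \<comment> \<open>Hence a prime avoiding \<open>a\<close> differs from \<open>m\<close> and is
      isolated.\<close>
    have "a \<in> m" using a(2) local_cring_prime_subset[OF assms(1)] by blast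
    then show "\<exists>f\<in>carrier R. {Q \<in> Spec R. f \<notin> Q} = {P}" using isolated P by blast
  qed
  then have cofinite: "finite (Spec R - U)" if "openin (flat_topology R) U" "U \<noteq> {}" for U
    using openin_flat_topology_cofinite that by blast
  have "\<exists>Q. Q \<in> A \<and> Q \<in> U" if "openin (flat_topology R) U" "P \<in> U" for P U
  proof (rule ccontr)
    assume "\<nexists>Q. Q \<in> A \<and> Q \<in> U"
    then have "A \<subseteq> Spec R - U" using assms(4) by blast
    then show False using cofinite that assms(5) finite_subset by blast
  qed
  then show ?thesis
    by (auto simp: in_closure_of topspace_flat_topology)
qed

end
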